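(* Let $(G,p)$ be a $d$-dimensional bar-joint framework with $t$-fold extrusion symmetry, where $G=H\square K_2^{\square t}=(V,E)$ and the points $p(V)$ affinely span at least $\mathbb{R}^{d-1}$. Let $\rho_0,\ldots,\rho_{r-1}$ ($r=2^t$) be the irreducible representations of $\Gamma=\mathbb{Z}_2^t$, and write $$\chi(P_V\otimes I_d)=\sum_{\kappa=0}^{r-1}\lambda_\kappa\chi(\rho_\kappa),\qquad \chi(P'_E)=\sum_{\kappa=0}^{r-1}\mu_\kappa\chi(\rho_\kappa),\qquad \chi\big((P_V\otimes I_d)^{(\mathcal T)}\big)=\sum_{\kappa=0}^{r-1}\nu_\kappa\chi(\rho_\kappa),$$ with non-negative integers $\lambda_\kappa,\mu_\kappa,\nu_\kappa$. Then for each $\kappa\in\{0,\ldots,r-1\}$: (i) If $\lambda_\kappa-\nu_\kappa>\mu_\kappa$, then $(G,p)$ has a non-zero infinitesimal motion that is symmetric with respect to $\rho_\kappa$. If $d=2$, this motion must be non-trivial (i.e. $(G,p)$ has a non-trivial infinitesimal motion that is symmetric with respect to $\rho_\kappa$). (ii) If $\lambda_\kappa-\nu_\kappa<\mu_\kappa$, then $(G,p)$ has a non-zero self-stress that is symmetric with respect to $\rho_\kappa$.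
   Context: Graphs are finite and simple. A (bar-joint) framework $(G,p)$ in $\mathbb{R}^d$ is a graph $G=(V,E)$ with a map $p:V\to\mathbb{R}^d$, $p_i=p(i)$. The points affinely span at least $\mathbb{R}^{d-1}$ if the affine hull of $p(V)$ has dimension at least $d-1$. The rigidity matrix $R(G,p)$ is the $|E|\times d|V|$ matrix whose row for $\{i,j\}\in E$ has $p_i-p_j$ in the columns of $i$, $p_j-p_i$ in the columns of $j$, and zeros elsewhere. An infinitesimal motion is an element $\dot p$ of the kernel of $R(G,p)$; it is trivial if there are a skew-symmetric matrix $S$ and a vector $b$ with $\dot p_i=Sp_i+b$ for all $i\in V$, and non-trivial otherwise. A self-stress is $\omega\in\mathbb{R}^{|E|}$ with $\omega^TR(G,p)=0$. $H\square K_2^{\square t}$ ($t\ge1$) has vertices $(v,\mathbf e)$, $v\in V(H)$, $\mathbf e\in\{0,1\}^t$, and edges $\{(v,\mathbf e),(w,\mathbf e)\}$ with $\{v,w\}\in E(H)$, and $\{(v,\mathbf e),(v,\mathbf e')\}$ with $\mathbf e,\mathbf e'$ differing in exactly one entry. $\Gamma=\mathbb{Z}_2^t$ acts on $G$ by $\gamma(v,\mathbf e)=(v,\mathbf e+\gamma)$ (addition mod 2). $(G,p)$ has $t$-fold extrusion symmetry if there are $\tau_1,\ldots,\tau_t\in\mathbb{R}^d\setminus\{0\}$ such that for every vertex $(v,\mathbf e)$ and every $\gamma\in\Gamma$, $p_{\gamma(v,\mathbf e)}=p_{(v,\mathbf e)}+\sum_{i\in X}\tau_i-\sum_{g\in Y}\tau_g$,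 where $X$ is the set of indices at which $\mathbf e$ has entry $0$ and $\gamma$ has entry $1$, and $Y$ is the set of indices at which both have entry $1$. $P_V(\gamma)=[\delta_{i,\gamma j}]_{i,j}$ and $P_E(\gamma)$ are the permutation matrices of $\gamma$ on $V$ and $E$. $P_V\otimes I_d$ is the external representation on $\mathbb{R}^{d|V|}$. The internal representation $P'_E$ on $\mathbb{R}^{|E|}$ is obtained from $P_E$ by: for each $\gamma$ and each edge $e=\{(v,\mathbf e),(v,\mathbf e')\}$ with $\mathbf e,\mathbf e'$ differing exactly in the $h$-th entry, with $f=\gamma e$, replace the $1$ in the $(e,f)$ and $(f,e)$ entries of $P_E(\gamma)$ by $-1$ iff $\gamma$ has a $1$ in the $h$-th entry. $\mathcal T$ is the space of infinitesimal translations ($\dot p_i=b$ for all $i\in V$, for some $b\in\mathbb{R}^d$); it is $(P_V\otimes I_d)$-invariant, and $(P_V\otimes I_d)^{(\mathcal T)}$ is the subrepresentation on $\mathcal T$. $\chi(\rho)$ denotes the character of $\rho$ (the vector of traces $\mathrm{tr}\,\rho(\gamma)$, $\gamma\in\Gamma$). The irreducible representations of $\Gamma$ are $\rho_\gamma(\gamma')=(-1)^{x_1'x_1+\dots+x_t'x_t}$ for $\gamma=(x_1,\dots,x_t)$, $\gamma'=(x'_1,\dots,x'_t)$, enumerated $\rho_0,\ldots,\rho_{r-1}$. A vector in $\mathbb{R}^{d|V|}$ (resp. $\mathbb{R}^{|E|}$) is symmetric with respect to $\rho_\kappa$ if every $\gamma\in\Gamma$ acts on it through $P_V\otimes I_d$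 (resp. $P'_E$) as multiplication by $\rho_\kappa(\gamma)$.
   Formalization: The "If d=2" sentence of (i) is asserted only for |V|≠2: for G=K_2 (H=K_1, t=1) in the plane, the non-trivial character has λ−ν=2>1=μ, yet its only symmetric infinitesimal motions are rotations about the midpoint, which are trivial. *)

theory Defs
  imports "HOL-Analysis.Analysis" "HOL-Library.Z2"
begin

section \<open>Bar-joint frameworks\<close>

text \<open>
  A finite simple graph is given by its vertex type \<open>'n\<close> and its set of edges, each edge being
  a set of two distinct vertices.
\<close>

definition simple_graph :: "'n::finite set set \<Rightarrow> bool" where
  "simple_graph E \<longleftrightarrow> (\<forall>e\<in>E. card e = 2)"

text \<open>
  The space \<open>\<real>\<^bsup>d|V|\<^esup>\<close> is \<open>real ^ ('n \<times> 'd)\<close>; the coordinate \<open>(i, k)\<close> is the \<open>k\<close>-th coordinate of the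
  velocity of vertex \<open>i\<close>.
\<close>

definition velocity :: "real ^ ('n::finite \<times> 'd::finite) \<Rightarrow> 'n \<Rightarrow> real ^ 'd" where
  "velocity u i = (\<chi> k. u $ (i, k))"

text \<open>
  Row \<open>e\<close> of the rigidity matrix. If \<open>e = {i, j}\<close> is an edge, then \<open>e - {i}\<close> is the singleton
  \<open>{j}\<close>, so the entries in the columns of \<open>i\<close> are those of \<open>p i - p j\<close>.
\<close>

definition rigidity_row ::
    "('n::finite \<Rightarrow> real ^ 'd::finite) \<Rightarrow> 'n set \<Rightarrow> real ^ ('n \<times> 'd)" where
  "rigidity_row p e =
    (\<chi> c. case c of (i, k) \<Rightarrow> if i \<in> e then (\<Sum>j\<in>e - {i}. (p i - p j) $ k) else 0)"

definition infinitesimal_motion ::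
    "'n::finite set set \<Rightarrow> ('n \<Rightarrow> real ^ 'd::finite) \<Rightarrow> real ^ ('n \<times> 'd) \<Rightarrow> bool" where
  "infinitesimal_motion E p u \<longleftrightarrow> (\<forall>e\<in>E. rigidity_row p e \<bullet> u = 0)"

definition trivial_motion ::
    "('n::finite \<Rightarrow> real ^ 'd::finite) \<Rightarrow> real ^ ('n \<times> 'd) \<Rightarrow> bool" where
  "trivial_motion p u \<longleftrightarrow>
    (\<exists>(S :: real ^ 'd ^ 'd) b. transpose S = - S \<and> (\<forall>i. velocity u i = S *v p i + b))"

text \<open>
  A vector of \<open>\<real>\<^bsup>|E|\<^esup>\<close> is represented by a function on all vertex sets of which only the values
  on \<open>E\<close> are significant; in particular it is non-zero iff it has a non-zero value on \<open>E\<close>.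
\<close>

definition self_stress ::
    "'n::finite set set \<Rightarrow> ('n \<Rightarrow> real ^ 'd::finite) \<Rightarrow> ('n set \<Rightarrow> real) \<Rightarrow> bool" where
  "self_stress E p \<omega> \<longleftrightarrow> (\<Sum>e\<in>E. \<omega> e *\<^sub>R rigidity_row p e) = 0"

section \<open>Extrusions\<close>

instance bit :: finite
proof
  have "(UNIV :: bit set) = {0, 1}"
    by (auto intro: bit.exhaust)
  then show "finite (UNIV :: bit set)"
    by (metis finite.emptyI finite.insertI)
qed

text \<open>
  The group \<open>\<Gamma> = \<int>\<^sub>2\<^sup>t\<close> is the additive group of \<open>bit ^ 't\<close>, with \<open>t = CARD('t) \<ge> 1\<close>.
\<close>

definition differ_exactly_at :: "'t::finite \<Rightarrow> bit ^ 't \<Rightarrow> bit ^ 't \<Rightarrow> bool" where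
  "differ_exactly_at h a a' \<longleftrightarrow> (\<forall>i. a $ i \<noteq> a' $ i \<longleftrightarrow> i = h)"

text \<open>The edge set of \<open>H \<box> K\<^sub>2\<^bsup>\<box>t\<^esup>\<close>, where \<open>EH\<close> is the edge set of \<open>H\<close>.\<close>

definition extrusion_edges :: "'v::finite set set \<Rightarrow> ('v \<times> (bit ^ 't::finite)) set set" where
  "extrusion_edges EH =
    {{(v, a), (w, a)} | v w a. {v, w} \<in> EH} \<union>
    {{(v, a), (v, a')} | v a a'. \<exists>h. differ_exactly_at h a a'}"

definition act :: "bit ^ 't::finite \<Rightarrow> 'v \<times> (bit ^ 't) \<Rightarrow> 'v \<times> (bit ^ 't)" where
  "act \<gamma> = (\<lambda>(v, a). (v, a + \<gamma>))"

definition extrusion_symmetry :: "('v::finite \<times> (bit ^ 't::finite) \<Rightarrow> real ^ 'd::finite) \<Rightarrow> bool" where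
  "extrusion_symmetry p \<longleftrightarrow>
    (\<exists>\<tau> :: 't \<Rightarrow> real ^ 'd. (\<forall>i. \<tau> i \<noteq> 0) \<and>
      (\<forall>v a \<gamma>. p (act \<gamma> (v, a)) =
        p (v, a) + (\<Sum>i\<in>{i. a $ i = 0 \<and> \<gamma> $ i = 1}. \<tau> i)
                 - (\<Sum>i\<in>{i. a $ i = 1 \<and> \<gamma> $ i = 1}. \<tau> i)))"

section \<open>Representations and characters\<close>

text \<open>The irreducible representations \<open>\<rho>\<^sub>\<kappa>\<close> are indexed by the elements \<open>\<kappa>\<close> of \<open>\<Gamma>\<close> itself.\<close>

definition irrep :: "bit ^ 't::finite \<Rightarrow> bit ^ 't \<Rightarrow> real" where
  "irrep \<kappa> \<gamma> = (- 1) ^ (\<Sum>i\<in>UNIV. of_bool (\<gamma> $ i = 1) * of_bool (\<kappa> $ i = 1))"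

definition vertex_perm_matrix ::
    "bit ^ 't::finite \<Rightarrow> real ^ ('v::finite \<times> (bit ^ 't)) ^ ('v \<times> (bit ^ 't))" where
  "vertex_perm_matrix \<gamma> = (\<chi> i j. if i = act \<gamma> j then 1 else 0)"

definition kronecker ::
    "real ^ 'm::finite ^ 'm \<Rightarrow> real ^ 'd::finite ^ 'd \<Rightarrow> real ^ ('m \<times> 'd) ^ ('m \<times> 'd)" where
  "kronecker A B = (\<chi> r c. case (r, c) of ((i, k), (j, l)) \<Rightarrow> A $ i $ j * B $ k $ l)"

definition external_rep ::
    "bit ^ 't::finite \<Rightarrow>
      real ^ (('v::finite \<times> (bit ^ 't)) \<times> 'd::finite) ^ (('v \<times> (bit ^ 't)) \<times> 'd)" where
  "external_rep \<gamma> = kronecker (vertex_perm_matrix \<gamma>) (mat 1)"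

definition edge_perm_matrix ::
    "bit ^ 't::finite \<Rightarrow> ('v::finite \<times> (bit ^ 't)) set \<Rightarrow> ('v \<times> (bit ^ 't)) set \<Rightarrow> real" where
  "edge_perm_matrix \<gamma> e f = (if e = act \<gamma> ` f then 1 else 0)"

text \<open>
  The internal representation, as a matrix with rows and columns indexed by the edges. Since \<open>\<gamma>\<close>
  is an involution that maps edges in direction \<open>h\<close> to edges in direction \<open>h\<close>, the
  condition below holds for \<open>(e, f)\<close> iff it holds for \<open>(f, e)\<close>.
\<close>

definition internal_rep ::
    "bit ^ 't::finite \<Rightarrow> ('v::finite \<times> (bit ^ 't)) set \<Rightarrow> ('v \<times> (bit ^ 't)) set \<Rightarrow> real" where
  "internal_rep \<gamma> e f =
    (if f = act \<gamma> ` e \<and>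
        (\<exists>v a a' h. e = {(v, a), (v, a')} \<and> differ_exactly_at h a a' \<and> \<gamma> $ h = 1)
     then - 1 else edge_perm_matrix \<gamma> e f)"

definition edge_trace :: "'e set \<Rightarrow> ('e \<Rightarrow> 'e \<Rightarrow> real) \<Rightarrow> real" where
  "edge_trace E M = (\<Sum>e\<in>E. M e e)"

definition infinitesimal_translations :: "(real ^ ('n::finite \<times> 'd::finite)) set" where
  "infinitesimal_translations = {u. \<exists>b. \<forall>i. velocity u i = b}"

text \<open>
  The trace of the restriction of the linear map \<open>f\<close> to an \<open>f\<close>-invariant subspace \<open>U\<close>, computed in
  some basis \<open>B\<close> of \<open>U\<close>; the value does not depend on the choice of \<open>B\<close>.
\<close>

definition trace_on :: "'a::euclidean_space set \<Rightarrow> ('a \<Rightarrow> 'a) \<Rightarrow> real" where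
  "trace_on U f =
    (let B = (SOME B. independent B \<and> span B = U) in \<Sum>b\<in>B. representation B (f b) b)"

definition symmetric_motion ::
    "bit ^ 't::finite \<Rightarrow> real ^ (('v::finite \<times> (bit ^ 't)) \<times> 'd::finite) \<Rightarrow> bool" where
  "symmetric_motion \<kappa> u \<longleftrightarrow> (\<forall>\<gamma>. external_rep \<gamma> *v u = irrep \<kappa> \<gamma> *\<^sub>R u)"

definition symmetric_stress ::
    "('v::finite \<times> (bit ^ 't::finite)) set set \<Rightarrow> bit ^ 't \<Rightarrow>
      (('v \<times> (bit ^ 't)) set \<Rightarrow> real) \<Rightarrow> bool" where
  "symmetric_stress E \<kappa> \<omega> \<longleftrightarrow>
    (\<forall>\<gamma>. \<forall>e\<in>E. (\<Sum>f\<in>E. internal_rep \<gamma> e f * \<omega> f) = irrep \<kappa> \<gamma> * \<omega> e)"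

end

theory Submission
  imports Defs
begin

text \<open>
  A motion symmetric with respect to \<open>\<rho>\<^sub>\<kappa>\<close> has the form \<open>u (v, a) = \<rho>\<^sub>\<kappa>(a) w(v)\<close>, so it is given by a
  vector \<open>w\<close> with \<open>d |V(H)|\<close> coordinates. On such motions the rigidity matrix reduces to one row for
  each edge of \<open>H\<close> and one row \<open>\<tau>\<^sub>h \<bullet> w(v) = 0\<close> for each vertex \<open>v\<close> of \<open>H\<close> and each direction \<open>h\<close>
  with \<open>\<kappa>\<^sub>h = 1\<close>. Orthogonality of characters shows that this block has \<open>\<mu>\<^sub>\<kappa>\<close> rows and \<open>\<lambda>\<^sub>\<kappa>\<close> columns,
  and that \<open>\<nu>\<^sub>\<kappa>\<close> is \<open>d\<close> for the trivial character and 0 otherwise. Counting dimensions gives kernel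
  and cokernel elements of the block, which lift to motions and stresses. In the plane a trivial
  motion that is symmetric with respect to a non-trivial character forces \<open>t = 1\<close> and all vertices
  of \<open>H\<close> at one point; then the velocity \<open>w\<close> can be cut down to a single vertex of \<open>H\<close>, which
  gives a non-trivial motion unless \<open>H\<close> has only one vertex.
\<close>

section \<open>Linear algebra\<close>

text \<open>Indexed families matter because rows may coincide: edges of H between coincident points
  all give the zero row. An injective family has a dependent image, and a repeated vector gives a
  relation with coefficients 1 and -1.\<close>

lemma nontrivial_relation_of_dim_less_card:
  fixes r :: "'i \<Rightarrow> 'a::euclidean_space"
  assumes "finite I" and "dim (r ` I) < card I"
  obtains c where "(\<Sum>i\<in>I. c i *\<^sub>R r i) = 0" and "\<exists>i\<in>I. c i \<noteq> 0"
proof (cases "inj_on r I")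
  case True
  then have "dim (r ` I) < card (r ` I)"
    using assms by (simp add: card_image)
  then have "dependent (r ` I)"
    using dim_eq_card_independent by fastforce
  then obtain u where u: "\<exists>v\<in>r ` I. u v \<noteq> 0" "(\<Sum>v\<in>r ` I. u v *\<^sub>R v) = 0"
    using assms(1) by (auto simp: dependent_finite)
  show thesis
    by (rule that[of "u \<circ> r"]) (use u True in \<open>auto simp: sum.reindex\<close>)
next
  case False
  then obtain i j where ij: "i \<in> I" "j \<in> I" "i \<noteq> j" "r i = r j"
    by (auto simp: inj_on_def)
  define c :: "'i \<Rightarrow> real" where "c = (\<lambda>k. if k = i then 1 else if k = j then - 1 else 0)"
  have "(\<Sum>k\<in>I. c k *\<^sub>R r k) = (\<Sum>k\<in>{i, j}. c k *\<^sub>R r k)"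
    using assms(1) ij by (intro sum.mono_neutral_right) (auto simp: c_def)
  also have "\<dots> = 0"
    using ij by (simp add: c_def)
  finally show thesis
    using ij(1) that by (metis c_def zero_neq_one)
qed

text \<open>The solution space is the orthogonal complement of the span of the vectors, and that
  span has dimension at most \<open>card I\<close>.\<close>

lemma DIM_le_dim_orthogonal_plus_card:
  fixes r :: "'i \<Rightarrow> 'a::euclidean_space"
  assumes "finite I"
  shows "DIM('a) \<le> dim {x. \<forall>i\<in>I. r i \<bullet> x = 0} + card I"
proof -
  have "{y \<in> UNIV. \<forall>x\<in>span (r ` I). orthogonal x y} = {x. \<forall>i\<in>I. r i \<bullet> x = 0}"
  proof -
    have "orthogonal x y" if "\<forall>i\<in>I. r i \<bullet> y = 0" "x \<in> span (r ` I)" for x y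
      using orthogonal_to_span[of x "r ` I" y] that
      by (force simp: orthogonal_def inner_commute)
    moreover have "r i \<in> span (r ` I)" if "i \<in> I" for i
      using that by (simp add: span_base)
    ultimately show ?thesis
      unfolding orthogonal_def by blast
  qed
  moreover have "dim (span (r ` I)) \<le> card I"
    using assms by (metis card_image_le dim_le_card' dim_span finite_imageI order_trans)
  ultimately show ?thesis
    using dim_subspace_orthogonal_to_vectors[of "span (r ` I)" UNIV] by simp
qed

lemma eq_uminus_self_imp_0:
  fixes x :: "'a::real_vector"
  assumes "x = - x"
  shows "x = 0"
proof -
  have "2 *\<^sub>R x = 0"
    using assms by (metis add.right_inverse scaleR_2)
  then show ?thesis
    by simp
qed

text \<open>On two coordinates a skew-symmetric matrix is a multiple of a quarter turn, hence
  invertible unless it is zero.\<close>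

lemma skew_symmetric_2_injective:
  fixes S :: "real ^ 'd::finite ^ 'd"
  assumes "CARD('d) = 2" and skew: "transpose S = - S" and "S *v x = 0" and "x \<noteq> 0"
  shows "S = 0"
proof -
  obtain k l :: 'd where kl: "UNIV = {k, l}" "k \<noteq> l"
    using assms(1) by (meson card_2_iff)
  have ij: "i = k \<or> i = l" for i
    using kl by blast
  have S: "S $ j $ i = - (S $ i $ j)" for i j
  proof -
    have "transpose S $ i $ j = (- S) $ i $ j"
      by (simp only: skew)
    then show ?thesis
      by (simp add: transpose_def)
  qed
  have diag: "S $ i $ i = 0" for i
    using S[of i i] by simp
  have sum_kl: "(\<Sum>j\<in>UNIV. f j) = f k + f l" for f :: "'d \<Rightarrow> real"
    unfolding kl(1) using kl(2) by simp
  have "(S *v x) $ k = S $ k $ l * x $ l" "(S *v x) $ l = - (S $ k $ l * x $ k)"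
    using diag S[of k l] by (simp_all add: matrix_vector_mult_def sum_kl)
  moreover have "x $ k \<noteq> 0 \<or> x $ l \<noteq> 0"
    using \<open>x \<noteq> 0\<close> ij by (auto simp: vec_eq_iff) metis
  ultimately have "S $ k $ l = 0"
    using assms(3) by auto
  then have "S $ i $ j = 0" for i j
    using ij[of i] ij[of j] diag S[of k l] by auto
  then show ?thesis
    by (simp add: vec_eq_iff)
qed

section \<open>Frameworks\<close>

lemma velocity_nth [simp]: "velocity u i $ k = u $ (i, k)"
  by (simp add: velocity_def)

lemma sum_prod_UNIV:
  "(\<Sum>c\<in>(UNIV :: ('a::finite \<times> 'b::finite) set). f c) = (\<Sum>i\<in>UNIV. \<Sum>k\<in>UNIV. f (i, k))"
  by (simp add: sum.cartesian_product flip: UNIV_Times_UNIV)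

lemma inner_eq_sum_velocity:
  fixes u w :: "real ^ ('n::finite \<times> 'd::finite)"
  shows "u \<bullet> w = (\<Sum>i\<in>UNIV. velocity u i \<bullet> velocity w i)"
  by (simp add: inner_vec_def sum_prod_UNIV)

lemma velocity_rigidity_row:
  "velocity (rigidity_row p e) i = (if i \<in> e then \<Sum>j\<in>e - {i}. p i - p j else 0)"
  by (simp add: rigidity_row_def vec_eq_iff)

lemma rigidity_row_inner:
  fixes u :: "real ^ ('n::finite \<times> 'd::finite)"
  assumes "x \<noteq> y"
  shows "rigidity_row p {x, y} \<bullet> u = (p x - p y) \<bullet> (velocity u x - velocity u y)"
proof -
  have "rigidity_row p {x, y} \<bullet> u =
      (\<Sum>i\<in>{x, y}. velocity (rigidity_row p {x, y}) i \<bullet> velocity u i)"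
    unfolding inner_eq_sum_velocity
    by (intro sum.mono_neutral_right) (auto simp: velocity_rigidity_row)
  also have "\<dots> = (p x - p y) \<bullet> (velocity u x - velocity u y)"
  proof -
    have "{x, y} - {x} = {y}" "{x, y} - {y} = {x}"
      using assms by auto
    with assms show ?thesis
      by (simp add: velocity_rigidity_row inner_diff_left inner_diff_right)
  qed
  finally show ?thesis .
qed

text \<open>This is the force balance at x: only edges through x contribute, and each of them is
  determined by its other end y.\<close>

lemma sum_rigidity_rows_nth:
  fixes p :: "'n::finite \<Rightarrow> real ^ 'd::finite"
  assumes "simple_graph E"
  shows "(\<Sum>e\<in>E. \<omega> e *\<^sub>R rigidity_row p e) $ (x, k) =
    (\<Sum>y | {x, y} \<in> E. \<omega> {x, y} * (p x - p y) $ k)"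
proof -
  have neq: "x \<noteq> y" if "{x, y} \<in> E" for y
    using assms that by (fastforce simp: simple_graph_def)
  have "(\<Sum>e\<in>E. \<omega> e *\<^sub>R rigidity_row p e) $ (x, k) =
      (\<Sum>e\<in>{e \<in> E. x \<in> e}. \<omega> e * (\<Sum>y\<in>e - {x}. (p x - p y) $ k))"
    by (simp add: rigidity_row_def sum.If_cases if_distrib Collect_conj_eq Int_commute cong: if_cong)
  also have "{e \<in> E. x \<in> e} = (\<lambda>y. {x, y}) ` {y. {x, y} \<in> E}"
  proof -
    have "\<exists>y. e = {x, y}" if "e \<in> E" "x \<in> e" for e
    proof -
      have "card e = 2"
        using assms that by (simp add: simple_graph_def)
      with that(2) show ?thesis
        unfolding card_2_iff by auto
    qed
    then show ?thesis
      by blast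
  qed
  also have "(\<Sum>e\<in>(\<lambda>y. {x, y}) ` {y. {x, y} \<in> E}. \<omega> e * (\<Sum>y\<in>e - {x}. (p x - p y) $ k)) =
      (\<Sum>y | {x, y} \<in> E. \<omega> {x, y} * (\<Sum>y\<in>{x, y} - {x}. (p x - p y) $ k))"
    by (subst sum.reindex) (auto simp: inj_on_def doubleton_eq_iff)
  also have "\<dots> = (\<Sum>y | {x, y} \<in> E. \<omega> {x, y} * (p x - p y) $ k)"
  proof (intro sum.cong refl)
    fix y assume "y \<in> {y. {x, y} \<in> E}"
    then have "{x, y} - {x} = {y}"
      using neq by auto
    then show "\<omega> {x, y} * (\<Sum>y\<in>{x, y} - {x}. (p x - p y) $ k) = \<omega> {x, y} * (p x - p y) $ k"
      by simp
  qed
  finally show ?thesis .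
qed

section \<open>Infinitesimal translations and traces on invariant subspaces\<close>

lemma infinitesimal_translations_eq_range:
  "infinitesimal_translations =
    range (\<lambda>b. (\<chi> c. b $ snd c) :: real ^ ('n::finite \<times> 'd::finite))"
  by (auto simp: infinitesimal_translations_def vec_eq_iff image_iff)

lemma subspace_infinitesimal_translations:
  "subspace (infinitesimal_translations :: (real ^ ('n::finite \<times> 'd::finite)) set)"
proof -
  have "linear (\<lambda>b. (\<chi> c. b $ snd c) :: real ^ ('n::finite \<times> 'd::finite))"
    by (rule linearI) (simp_all add: vec_eq_iff)
  then show ?thesis
    unfolding infinitesimal_translations_eq_range
    by (intro linear_subspace_image) simp_all
qed

lemma dim_infinitesimal_translations:
  "dim (infinitesimal_translations :: (real ^ ('n::finite \<times> 'd::finite)) set) = CARD('d)"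
proof -
  have "linear (\<lambda>b. (\<chi> c. b $ snd c) :: real ^ ('n \<times> 'd))"
    by (rule linearI) (simp_all add: vec_eq_iff)
  moreover have "inj (\<lambda>b. (\<chi> c. b $ snd c) :: real ^ ('n \<times> 'd))"
    by (rule injI) (simp add: vec_eq_iff)
  ultimately have "dim (range (\<lambda>b. (\<chi> c. b $ snd c) :: real ^ ('n \<times> 'd))) =
      dim (UNIV :: (real ^ 'd) set)"
    by (intro dim_image_eq) simp_all
  then show ?thesis
    by (simp add: infinitesimal_translations_eq_range)
qed

lemma rigidity_row_orthogonal_translation:
  fixes p :: "'n::finite \<Rightarrow> real ^ 'd::finite"
  assumes "card e = 2" and "u \<in> infinitesimal_translations"
  shows "rigidity_row p e \<bullet> u = 0"
proof -
  obtain x y where "e = {x, y}" "x \<noteq> y"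
    using assms(1) by (meson card_2_iff)
  with assms(2) show ?thesis
    by (auto simp: infinitesimal_translations_def rigidity_row_inner)
qed

text \<open>Each basis vector in U contributes 1 to the trace, whichever basis \<open>SOME\<close>
  picks.\<close>

lemma trace_on_eq_dim:
  assumes "subspace U" and "\<And>u. u \<in> U \<Longrightarrow> f u = u"
  shows "trace_on U f = real (dim U)"
proof -
  define B where "B = (SOME B. independent B \<and> span B = U)"
  have "\<exists>B. independent B \<and> span B = U"
    using assms(1) by (metis basis_exists span_subspace)
  then have B: "independent B" "span B = U"
    unfolding B_def by (metis (mono_tags, lifting) someI_ex)+
  have "trace_on U f = (\<Sum>b\<in>B. representation B (f b) b)"
    by (simp add: trace_on_def B_def Let_def)
  also have "\<dots> = (\<Sum>b\<in>B. 1)"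
    using B assms(2)
    by (intro sum.cong) (auto simp: representation_basis span_base)
  also have "\<dots> = real (dim U)"
    using B dim_eq_card_independent dim_span by fastforce
  finally show ?thesis .
qed

section \<open>Characters of elementary abelian 2-groups\<close>

lemma bit_vec_add_self [simp]: "(a :: bit ^ 't::finite) + a = 0"
  by (simp add: vec_eq_iff)

lemma bit_vec_add_add_self [simp]: "(a :: bit ^ 't::finite) + b + b = a"
  by (simp add: add.assoc)

lemma bit_vec_add_eq_0_iff: "(a :: bit ^ 't::finite) + b = 0 \<longleftrightarrow> a = b"
  by (metis add_left_cancel bit_vec_add_self)

text \<open>The product form lets \<open>irrep_add\<close> be checked one coordinate at a
  time.\<close>

lemma irrep_eq_prod:
  "irrep \<kappa> \<gamma> = (\<Prod>i\<in>UNIV. if \<gamma> $ i = 1 \<and> \<kappa> $ i = 1 then - 1 else 1)"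
  unfolding irrep_def power_sum by (intro prod.cong) auto

lemma irrep_commute: "irrep \<kappa> \<gamma> = irrep \<gamma> \<kappa>"
  by (simp add: irrep_eq_prod conj_commute)

lemma irrep_add: "irrep \<kappa> (a + b) = irrep \<kappa> a * irrep \<kappa> b"
  unfolding irrep_eq_prod prod.distrib[symmetric]
proof (intro prod.cong refl)
  fix i
  show "(if (a + b) $ i = 1 \<and> \<kappa> $ i = 1 then - 1 else 1) =
      (if a $ i = 1 \<and> \<kappa> $ i = 1 then - 1 else 1) *
      (if b $ i = 1 \<and> \<kappa> $ i = 1 then - 1 else (1::real))"
    by (cases "a $ i"; cases "b $ i") simp_all
qed

lemma irrep_0_right [simp]: "irrep \<kappa> 0 = 1"
  by (simp add: irrep_def)

lemma irrep_0_left [simp]: "irrep 0 \<gamma> = 1"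
  by (simp add: irrep_def)

lemma irrep_nonzero [simp]: "irrep \<kappa> a \<noteq> 0"
  by (simp add: irrep_def)

lemma irrep_axis [simp]: "irrep \<kappa> (axis h 1) = (if \<kappa> $ h = 1 then - 1 else 1)"
proof -
  have "irrep \<kappa> (axis h 1) = (\<Prod>i\<in>UNIV. if i = h then if \<kappa> $ h = 1 then - 1 else 1 else 1)"
    unfolding irrep_eq_prod by (intro prod.cong) (auto simp: axis_def)
  then show ?thesis
    by simp
qed

lemma sum_irrep:
  "(\<Sum>\<gamma>\<in>UNIV. irrep \<kappa> \<gamma>) = (if \<kappa> = 0 then real CARD(bit ^ 't) else 0)"
  for \<kappa> :: "bit ^ 't::finite"
proof (cases "\<kappa> = 0")
  case False
  then obtain h where h: "\<kappa> $ h = 1"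
    by (auto simp: vec_eq_iff)
  \<comment> \<open>Translation by \<open>axis h 1\<close> permutes the group and reverses the sign
    of every term, so the sum equals its own negative.\<close>
  have "(\<Sum>\<gamma>\<in>UNIV. irrep \<kappa> \<gamma>) = (\<Sum>\<gamma>\<in>UNIV. irrep \<kappa> (\<gamma> + axis h 1))"
    by (intro sum.reindex_bij_witness[of _ "\<lambda>\<gamma>. \<gamma> + axis h 1" "\<lambda>\<gamma>. \<gamma> + axis h 1"]) simp_all
  also have "\<dots> = - (\<Sum>\<gamma>\<in>UNIV. irrep \<kappa> \<gamma>)"
    using h by (simp add: irrep_add sum_negf)
  finally show ?thesis
    using False by simp
qed simp

text \<open>The characters are real, so no conjugation appears. The product of the characters of
  \<kappa> and \<kappa>' is that of \<open>\<kappa> + \<kappa>'\<close>, whose sum over the group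
  vanishes unless \<kappa> = \<kappa>'. This recovers a multiplicity from a character.\<close>

lemma irrep_orthogonality:
  fixes m :: "bit ^ 't::finite \<Rightarrow> nat"
  assumes "\<And>\<gamma>. X \<gamma> = (\<Sum>\<kappa>\<in>UNIV. real (m \<kappa>) * irrep \<kappa> \<gamma>)"
  shows "(\<Sum>\<gamma>\<in>UNIV. irrep \<kappa> \<gamma> * X \<gamma>) = real CARD(bit ^ 't) * real (m \<kappa>)"
proof -
  have "(\<Sum>\<gamma>\<in>UNIV. irrep \<kappa> \<gamma> * X \<gamma>) =
      (\<Sum>\<kappa>'\<in>UNIV. real (m \<kappa>') * (\<Sum>\<gamma>\<in>UNIV. irrep (\<kappa> + \<kappa>') \<gamma>))"
    unfolding assms sum_distrib_left
    by (subst sum.swap) (simp add: irrep_commute[of "_ + _"] irrep_add irrep_commute mult_ac)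
  also have "\<dots> = (\<Sum>\<kappa>'\<in>UNIV. if \<kappa>' = \<kappa> then real (m \<kappa>) * real CARD(bit ^ 't) else 0)"
  proof (intro sum.cong refl)
    fix \<kappa>' :: "bit ^ 't"
    show "real (m \<kappa>') * (\<Sum>\<gamma>\<in>UNIV. irrep (\<kappa> + \<kappa>') \<gamma>) =
        (if \<kappa>' = \<kappa> then real (m \<kappa>) * real CARD(bit ^ 't) else 0)"
      by (auto simp: sum_irrep bit_vec_add_eq_0_iff simp del: CARD_vec)
  qed
  finally show ?thesis
    by (simp del: CARD_vec)
qed

section \<open>Edges of extrusions\<close>

lemma differ_exactly_at_iff: "differ_exactly_at h a a' \<longleftrightarrow> a' = a + axis h 1"
proof -
  have "(a $ i \<noteq> a' $ i \<longleftrightarrow> i = h) \<longleftrightarrow> a' $ i = (a + axis h 1) $ i" for i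
    by (cases "a $ i"; cases "a' $ i") (auto simp: axis_def)
  then show ?thesis
    by (simp add: differ_exactly_at_def vec_eq_iff)
qed

lemma act_act [simp]: "act \<gamma> (act \<gamma> x) = x"
  by (cases x) (simp add: act_def)

lemma image_act_image_act [simp]: "act \<gamma> ` act \<gamma> ` e = e"
  by (simp add: image_image)

lemma act_Pair [simp]: "act \<gamma> (v, a) = (v, a + \<gamma>)"
  by (simp add: act_def)

lemma axis_1_neq_0: "axis h (1::bit) \<noteq> 0"
  by simp

text \<open>The edges are split by their stabilizers in the group: trivial for the copies of edges
  of H, generated by \<open>axis h 1\<close> for the edges in direction h.\<close>

definition base_edges :: "'v::finite set set \<Rightarrow> ('v \<times> (bit ^ 't::finite)) set set" where
  "base_edges EH = {{(v, a), (w, a)} | v w a. {v, w} \<in> EH}"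

definition extruded_edges :: "'t::finite \<Rightarrow> ('v::finite \<times> (bit ^ 't)) set set" where
  "extruded_edges h = {{(v, a), (v, a + axis h 1)} | v a. True}"

lemma extrusion_edges_eq: "extrusion_edges EH = base_edges EH \<union> (\<Union>h. extruded_edges h)"
  unfolding extrusion_edges_def base_edges_def extruded_edges_def differ_exactly_at_iff by blast

lemma simple_graph_neq: "simple_graph EH \<Longrightarrow> {v, w} \<in> EH \<Longrightarrow> v \<noteq> w"
  by (fastforce simp: simple_graph_def)

lemma base_extruded_disjoint:
  "simple_graph EH \<Longrightarrow> base_edges EH \<inter> extruded_edges h = {}"
  by (auto simp: base_edges_def extruded_edges_def doubleton_eq_iff dest: simple_graph_neq)

text \<open>Over \<open>bit\<close> the vector \<open>axis h 1\<close> is its own negative, so an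
  extruded edge has exactly two descriptions, one from each end.\<close>

lemma extruded_edge_eq_iff:
  "{(v, a), (v, a + axis h 1)} = {(w, b), (w, b + axis h' (1::bit))} \<longleftrightarrow>
    v = w \<and> h = h' \<and> (a = b \<or> a = b + axis h 1)"
proof -
  have "a + axis h 1 = b + axis h' (1::bit) \<longleftrightarrow> h = h'" if "a = b" for a b
    using that by (simp add: axis_eq_axis)
  moreover have "a + axis h 1 = b \<longleftrightarrow> h = h'" if "a = b + axis h' (1::bit)" for a b
    using that by (metis add.assoc add_left_cancel axis_eq_axis bit_vec_add_add_self one_neq_zero)
  ultimately show ?thesis
    by (auto simp: doubleton_eq_iff)
qed

lemma extruded_edges_disjoint: "h \<noteq> h' \<Longrightarrow> extruded_edges h \<inter> extruded_edges h' = {}"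
  by (auto simp: extruded_edges_def extruded_edge_eq_iff)

lemma simple_graph_extrusion_edges:
  "simple_graph EH \<Longrightarrow> simple_graph (extrusion_edges EH)"
  by (subst simple_graph_def)
    (auto simp: extrusion_edges_eq base_edges_def extruded_edges_def card_insert_if
      dest: simple_graph_neq)

text \<open>With this list the force balance at a vertex splits into a sum over neighbours in H and
  a sum over directions.\<close>

lemma extrusion_edges_neighbours:
  assumes "simple_graph EH"
  shows "{y. {(v, a), y} \<in> extrusion_edges EH} =
    (\<lambda>w. (w, a)) ` {w. {v, w} \<in> EH} \<union> range (\<lambda>h. (v, a + axis h 1))"
    (is "?L = ?R")
proof
  show "?L \<subseteq> ?R"
  proof
    fix y assume "y \<in> ?L"
    then consider v' w' a' where "{(v, a), y} = {(v', a'), (w', a')}" "{v', w'} \<in> EH"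
      | v' a' h where "{(v, a), y} = {(v', a'), (v', a' + axis h 1)}"
      by (auto simp: extrusion_edges_eq base_edges_def extruded_edges_def)
    then consider w where "{v, w} \<in> EH" "y = (w, a)" | h where "y = (v, a + axis h 1)"
    proof cases
      case 1
      then show ?thesis
        using that(1) by (auto simp: doubleton_eq_iff insert_commute)
    next
      case 2
      then show ?thesis
        using that(2) by (fastforce simp: doubleton_eq_iff)
    qed
    then show "y \<in> ?R"
      by cases auto
  qed
  have "{(v, a), (v, a + axis h 1)} \<in> extruded_edges h" for h
    by (auto simp: extruded_edges_def)
  then show "?R \<subseteq> ?L"
    unfolding extrusion_edges_eq base_edges_def by fast
qed

lemma act_extrusion_edges:
  "e \<in> extrusion_edges EH \<Longrightarrow> act \<gamma> ` e \<in> extrusion_edges EH"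
proof -
  assume "e \<in> extrusion_edges EH"
  then consider v w a where "e = {(v, a), (w, a)}" "{v, w} \<in> EH"
    | v a h where "e = {(v, a), (v, a + axis h 1)}"
    by (auto simp: extrusion_edges_eq base_edges_def extruded_edges_def)
  then show ?thesis
  proof cases
    case 1
    then show ?thesis
      by (auto simp: extrusion_edges_eq base_edges_def)
  next
    case (2 v a h)
    then have "act \<gamma> ` e = {(v, a + \<gamma>), (v, a + \<gamma> + axis h 1)}"
      by (simp add: add_ac)
    then show ?thesis
      by (auto simp: extrusion_edges_eq extruded_edges_def)
  qed
qed

lemma card_base_edges:
  assumes "simple_graph EH"
  shows "card (base_edges EH :: ('v::finite \<times> (bit ^ 't::finite)) set set) =
    card EH * CARD(bit ^ 't)"
proof -
  \<comment> \<open>Written as a product, the copy of e in layer a determines both factors, because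
    e is non-empty.\<close>
  have "(base_edges EH :: ('v \<times> (bit ^ 't)) set set) = (\<lambda>(e, a). e \<times> {a}) ` (EH \<times> UNIV)"
  proof -
    have "\<exists>v w. e = {v, w}" if "e \<in> EH" for e
      using assms that unfolding simple_graph_def card_2_iff by blast
    then show ?thesis
      unfolding base_edges_def by (auto simp: image_iff) blast+
  qed
  moreover have "inj_on (\<lambda>(e, a). e \<times> {a}) (EH \<times> (UNIV :: (bit ^ 't) set))"
    using assms by (auto simp: inj_on_def simple_graph_def times_eq_iff)
  ultimately show ?thesis
    by (simp add: card_image card_cartesian_product del: CARD_vec)
qed

lemma card_coordinate_0: "2 * card {a :: bit ^ 't::finite. a $ h = 0} = CARD(bit ^ 't)"
proof -
  have "card {a :: bit ^ 't. a $ h = 0} = card {a :: bit ^ 't. a $ h = 1}"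
    by (rule bij_betw_same_card[of "\<lambda>a. a + axis h 1"],
        rule bij_betw_byWitness[of _ "\<lambda>a. a + axis h 1"]) auto
  moreover have "(UNIV :: (bit ^ 't) set) = {a. a $ h = 0} \<union> {a. a $ h = 1}"
    by auto
  then have "CARD(bit ^ 't) = card {a :: bit ^ 't. a $ h = 0} + card {a :: bit ^ 't. a $ h = 1}"
    by (metis (mono_tags, lifting) card_Un_disjoint disjoint_iff finite mem_Collect_eq zero_neq_one)
  ultimately show ?thesis
    by simp
qed

lemma card_extruded_edges:
  "2 * card (extruded_edges h :: ('v::finite \<times> (bit ^ 't::finite)) set set) =
    CARD('v) * CARD(bit ^ 't)"
proof -
  let ?f = "\<lambda>(v, a). {(v, a), (v, a + axis h 1)}"
  \<comment> \<open>Requiring the entry 0 at h selects one end of every edge in direction h.\<close>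
  let ?A = "(UNIV :: 'v set) \<times> {a :: bit ^ 't. a $ h = 0}"
  have "extruded_edges h = ?f ` ?A"
  proof
    show "extruded_edges h \<subseteq> ?f ` ?A"
    proof
      fix e :: "('v \<times> (bit ^ 't)) set" assume "e \<in> extruded_edges h"
      then obtain v a where e: "e = {(v, a), (v, a + axis h 1)}"
        by (auto simp: extruded_edges_def)
      show "e \<in> ?f ` ?A"
      proof (cases "a $ h = 0")
        case True
        then show ?thesis
          using e by auto
      next
        case False
        then have "(a + axis h 1) $ h = 0"
          by simp
        moreover have "e = ?f (v, a + axis h 1)"
          using e by (simp add: insert_commute)
        ultimately show ?thesis
          by blast
      qed
    qed
  qed (auto simp: extruded_edges_def)
  moreover have "inj_on ?f ?A"
    by (auto simp: inj_on_def extruded_edge_eq_iff)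
  ultimately have "card (extruded_edges h :: ('v \<times> (bit ^ 't)) set set) =
      CARD('v) * card {a :: bit ^ 't. a $ h = 0}"
    by (simp add: card_image card_cartesian_product)
  then show ?thesis
    using card_coordinate_0[of h] by (simp del: CARD_vec)
qed

section \<open>Multiplicities\<close>

definition edge_sign :: "bit ^ 't::finite \<Rightarrow> ('v::finite \<times> (bit ^ 't)) set \<Rightarrow> real" where
  "edge_sign \<gamma> e =
    (if \<exists>v a a' h. e = {(v, a), (v, a')} \<and> differ_exactly_at h a a' \<and> \<gamma> $ h = 1 then - 1 else 1)"

text \<open>Since \<gamma> is an involution, e is the image of f iff f is the image of e. So every
  row has a single non-zero entry.\<close>

lemma internal_rep_eq: "internal_rep \<gamma> e f = (if f = act \<gamma> ` e then edge_sign \<gamma> e else 0)"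
  by (auto simp: internal_rep_def edge_sign_def edge_perm_matrix_def)

lemma edge_sign_base: "v \<noteq> w \<Longrightarrow> edge_sign \<gamma> {(v, a), (w, a)} = 1"
  by (auto simp: edge_sign_def doubleton_eq_iff)

lemma edge_sign_extruded:
  "edge_sign \<gamma> {(v, a), (v, a + axis h 1)} = (if \<gamma> $ h = 1 then - 1 else 1)"
  unfolding edge_sign_def differ_exactly_at_iff by (auto simp: extruded_edge_eq_iff)

text \<open>A non-zero \<gamma> changes the layer of a base edge, so only the identity
  contributes.\<close>

lemma sum_irrep_internal_base:
  fixes \<kappa> :: "bit ^ 't::finite"
  assumes "simple_graph EH" and "e \<in> base_edges EH"
  shows "(\<Sum>\<gamma>\<in>UNIV. irrep \<kappa> \<gamma> * internal_rep \<gamma> e e) = 1"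
proof -
  obtain v w a where e: "e = {(v, a), (w, a)}" "v \<noteq> w"
    using assms by (auto simp: base_edges_def dest: simple_graph_neq)
  have "(\<Sum>\<gamma>\<in>UNIV. irrep \<kappa> \<gamma> * internal_rep \<gamma> e e) = 
      (\<Sum>\<gamma>\<in>(UNIV :: (bit ^ 't) set). if \<gamma> = 0 then 1 else 0)"
  proof (intro sum.cong refl)
    fix \<gamma> :: "bit ^ 't"
    have "e = act \<gamma> ` e \<longleftrightarrow> \<gamma> = 0"
      using e by (auto simp: doubleton_eq_iff)
    then show "irrep \<kappa> \<gamma> * internal_rep \<gamma> e e = (if \<gamma> = 0 then 1 else 0)"
      using e by (auto simp: internal_rep_eq edge_sign_base)
  qed
  then show ?thesis
    by simp
qed

text \<open>The stabilizer of e consists of 0 and \<open>axis h 1\<close>, and the latter acts on e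
  with sign -1. The sum is therefore \<open>1 - irrep \<kappa> (axis h 1)\<close>.\<close>

lemma sum_irrep_internal_extruded:
  fixes \<kappa> :: "bit ^ 't::finite"
  assumes "e \<in> extruded_edges h"
  shows "(\<Sum>\<gamma>\<in>UNIV. irrep \<kappa> \<gamma> * internal_rep \<gamma> e e) = (if \<kappa> $ h = 1 then 2 else 0)"
proof -
  obtain v a where e: "e = {(v, a), (v, a + axis h 1)}"
    using assms by (auto simp: extruded_edges_def)
  have fixed: "e = act \<gamma> ` e \<longleftrightarrow> \<gamma> \<in> {0, axis h 1}" for \<gamma>
  proof -
    have "act \<gamma> ` e = {(v, a + \<gamma>), (v, (a + \<gamma>) + axis h 1)}"
      using e by (simp add: add_ac)
    then have "e = act \<gamma> ` e \<longleftrightarrow> a = a + \<gamma> \<or> a = a + \<gamma> + axis h 1"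
      using e by (simp add: extruded_edge_eq_iff)
    also have "\<dots> \<longleftrightarrow> \<gamma> \<in> {0, axis h 1}"
      by (simp add: add.assoc bit_vec_add_eq_0_iff)
    finally show ?thesis .
  qed
  have "(\<Sum>\<gamma>\<in>UNIV. irrep \<kappa> \<gamma> * internal_rep \<gamma> e e) =
      (\<Sum>\<gamma>\<in>{0, axis h 1}. irrep \<kappa> \<gamma> * edge_sign \<gamma> e)"
    by (intro sum.mono_neutral_cong_right) (auto simp: internal_rep_eq fixed)
  also have "\<dots> = (if \<kappa> $ h = 1 then 2 else 0)"
    using axis_1_neq_0[of h] by (simp add: e edge_sign_extruded)
  finally show ?thesis .
qed

text \<open>Exchanging the sums over \<gamma> and over edges leaves the contributions of single
  edges. A direction has only half as many edges as the extrusion has vertices, but where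
  \<open>\<kappa> $ h = 1\<close> each of them counts 2.\<close>

lemma internal_multiplicity:
  fixes EH :: "'v::finite set set" and mu :: "bit ^ 't::finite \<Rightarrow> nat"
  assumes EH: "simple_graph EH"
    and "\<And>\<gamma>. edge_trace (extrusion_edges EH :: ('v \<times> (bit ^ 't)) set set) (internal_rep \<gamma>) =
      (\<Sum>\<kappa>\<in>UNIV. real (mu \<kappa>) * irrep \<kappa> \<gamma>)"
  shows "mu \<kappa> = card EH + card {h. \<kappa> $ h = 1} * CARD('v)"
proof -
  let ?E = "extrusion_edges EH :: ('v \<times> (bit ^ 't)) set set"
  let ?F = "\<lambda>e :: ('v \<times> (bit ^ 't)) set. \<Sum>\<gamma>\<in>UNIV. irrep \<kappa> \<gamma> * internal_rep \<gamma> e e"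
  let ?N = "CARD(bit ^ 't)"
  have "real ?N * real (mu \<kappa>) = (\<Sum>e\<in>?E. ?F e)"
    unfolding irrep_orthogonality[OF assms(2), symmetric] edge_trace_def sum_distrib_left
    by (rule sum.swap)
  also have "\<dots> = (\<Sum>e\<in>base_edges EH. ?F e) + (\<Sum>h\<in>UNIV. \<Sum>e\<in>extruded_edges h. ?F e)"
    unfolding extrusion_edges_eq using base_extruded_disjoint[OF EH]
    by (subst sum.union_disjoint, simp, simp, blast, subst sum.UNION_disjoint)
      (auto simp: extruded_edges_disjoint)
  also have "(\<Sum>e\<in>base_edges EH. ?F e) = real (card EH * ?N)"
    by (simp add: sum_irrep_internal_base[OF EH] card_base_edges[OF EH] del: CARD_vec)
  also have "(\<Sum>h\<in>UNIV. \<Sum>e\<in>extruded_edges h. ?F e) =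
      (\<Sum>h\<in>UNIV. if \<kappa> $ h = 1 then real (CARD('v) * ?N) else 0)"
  proof (intro sum.cong refl)
    fix h
    show "(\<Sum>e\<in>extruded_edges h. ?F e) = (if \<kappa> $ h = 1 then real (CARD('v) * ?N) else 0)"
      using card_extruded_edges[where 'v = 'v, of h]
      by (simp add: sum_irrep_internal_extruded del: CARD_vec of_nat_mult flip: of_nat_mult)
  qed
  also have "\<dots> = real (card {h. \<kappa> $ h = 1} * CARD('v) * ?N)"
    by (simp add: sum.If_cases del: CARD_vec)
  also have "real (card EH * ?N) + \<dots> = real ?N * real (card EH + card {h. \<kappa> $ h = 1} * CARD('v))"
    by (simp add: algebra_simps del: CARD_vec)
  finally have "real (mu \<kappa>) = real (card EH + card {h. \<kappa> $ h = 1} * CARD('v))"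
    by (simp del: CARD_vec)
  then show ?thesis
    by (simp only: of_nat_eq_iff)
qed

lemma external_rep_mult_nth:
  "(external_rep \<gamma> *v u) $ (x, k) = u $ (act \<gamma> x, k)"
proof -
  have "x = act \<gamma> y \<longleftrightarrow> y = act \<gamma> x" for y
    by auto
  then have "(external_rep \<gamma> *v u) $ (x, k) =
      (\<Sum>y\<in>UNIV. \<Sum>l\<in>UNIV. if y = act \<gamma> x then if l = k then u $ (y, l) else 0 else 0)"
    by (auto simp: matrix_vector_mult_def external_rep_def kronecker_def vertex_perm_matrix_def
        mat_def sum_prod_UNIV[where 'b = 'c] intro!: sum.cong)
  also have "\<dots> = (\<Sum>y\<in>UNIV. if y = act \<gamma> x then u $ (y, k) else 0)"
    by (intro sum.cong) auto
  finally show ?thesis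
    by simp
qed

text \<open>The group acts freely on the vertices, so the character vanishes off the identity: the
  representation is a multiple of the regular one.\<close>

lemma external_multiplicity:
  fixes lam :: "bit ^ 't::finite \<Rightarrow> nat"
  assumes "\<And>\<gamma>. trace (external_rep \<gamma> ::
        real ^ (('v::finite \<times> (bit ^ 't)) \<times> 'd::finite) ^ (('v \<times> (bit ^ 't)) \<times> 'd))
      = (\<Sum>\<kappa>\<in>UNIV. real (lam \<kappa>) * irrep \<kappa> \<gamma>)"
  shows "lam \<kappa> = CARD('v) * CARD('d)"
proof -
  let ?N = "CARD(bit ^ 't)"
  have tr: "trace (external_rep \<gamma> ::
        real ^ (('v \<times> (bit ^ 't)) \<times> 'd) ^ (('v \<times> (bit ^ 't)) \<times> 'd)) =
      (if \<gamma> = 0 then real (CARD('v) * ?N * CARD('d)) else 0)" for \<gamma> :: "bit ^ 't"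
  proof -
    have "(external_rep \<gamma> ::
        real ^ (('v \<times> (bit ^ 't)) \<times> 'd) ^ (('v \<times> (bit ^ 't)) \<times> 'd)) $ c $ c =
        (if \<gamma> = 0 then 1 else 0)" for c
      by (cases c) (auto simp: external_rep_def kronecker_def vertex_perm_matrix_def mat_def)
    then show ?thesis
      by (simp add: trace_def card_cartesian_product del: CARD_vec)
  qed
  have "real ?N * real (lam \<kappa>) =
      (\<Sum>\<gamma>\<in>(UNIV :: (bit ^ 't) set). if \<gamma> = 0 then real (CARD('v) * ?N * CARD('d)) else 0)"
    unfolding irrep_orthogonality[OF assms, symmetric] tr
    by (intro sum.cong) auto
  also have "\<dots> = real ?N * real (CARD('v) * CARD('d))"
    by (simp del: CARD_vec)
  finally show ?thesis
    by (simp del: CARD_vec of_nat_mult)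
qed

text \<open>The group permutes vertices and leaves velocity vectors unchanged, so it fixes every
  translation and only the trivial character occurs.\<close>

lemma translation_multiplicity:
  fixes nu :: "bit ^ 't::finite \<Rightarrow> nat"
  assumes "\<And>\<gamma>. trace_on
      (infinitesimal_translations :: (real ^ (('v::finite \<times> (bit ^ 't)) \<times> 'd::finite)) set)
      (\<lambda>u. external_rep \<gamma> *v u) = (\<Sum>\<kappa>\<in>UNIV. real (nu \<kappa>) * irrep \<kappa> \<gamma>)"
  shows "nu \<kappa> = (if \<kappa> = 0 then CARD('d) else 0)"
proof -
  have tr: "trace_on
      (infinitesimal_translations :: (real ^ (('v \<times> (bit ^ 't)) \<times> 'd)) set)
      (\<lambda>u. external_rep \<gamma> *v u) = real CARD('d)" for \<gamma>
    by (subst trace_on_eq_dim[OF subspace_infinitesimal_translations])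
      (auto simp: infinitesimal_translations_eq_range vec_eq_iff external_rep_mult_nth
        dim_infinitesimal_translations[unfolded infinitesimal_translations_eq_range])
  have "real CARD(bit ^ 't) * real (nu \<kappa>) = (\<Sum>\<gamma>\<in>UNIV. irrep \<kappa> \<gamma>) * real CARD('d)"
    unfolding irrep_orthogonality[OF assms, symmetric] tr by (rule sum_distrib_right[symmetric])
  then show ?thesis
    by (auto simp: sum_irrep simp del: CARD_vec)
qed

section \<open>Symmetry blocks of the rigidity matrix\<close>

definition symmetric_lift ::
    "bit ^ 't::finite \<Rightarrow> real ^ ('v::finite \<times> 'd::finite) \<Rightarrow> real ^ (('v \<times> (bit ^ 't)) \<times> 'd)" where
  "symmetric_lift \<kappa> w = (\<chi> c. case c of ((v, a), k) \<Rightarrow> irrep \<kappa> a * w $ (v, k))"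

lemma velocity_symmetric_lift:
  "velocity (symmetric_lift \<kappa> w) (v, a) = irrep \<kappa> a *\<^sub>R velocity w v"
  by (simp add: symmetric_lift_def vec_eq_iff)

lemma symmetric_motion_symmetric_lift: "symmetric_motion \<kappa> (symmetric_lift \<kappa> w)"
  unfolding symmetric_motion_def vec_eq_iff
  by (auto simp: external_rep_mult_nth symmetric_lift_def irrep_add)

lemma symmetric_lift_eq_0_iff: "symmetric_lift \<kappa> w = 0 \<longleftrightarrow> w = 0"
  by (auto simp: symmetric_lift_def vec_eq_iff)

text \<open>
  Directions \<open>h\<close> with \<open>\<kappa> $ h = 0\<close> contribute no row: both ends of such an edge have the same velocity.
\<close>

definition orbit_index :: "'v set set \<Rightarrow> bit ^ 't::finite \<Rightarrow> ('v set + 't \<times> 'v) set" where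
  "orbit_index EH \<kappa> = EH <+> ({h. \<kappa> $ h = 1} \<times> UNIV)"

text \<open>In the second case this is the row of the edge from \<open>(v, 0)\<close> to
  \<open>(v, axis h 1)\<close>, restricted to the columns of \<open>(v, 0)\<close>. The minus sign
  arises because the first end minus the second is \<open>- \<tau> h\<close>.\<close>

definition orbit_row ::
    "('v::finite \<Rightarrow> real ^ 'd::finite) \<Rightarrow> ('t \<Rightarrow> real ^ 'd) \<Rightarrow> 'v set + 't \<times> 'v \<Rightarrow> real ^ ('v \<times> 'd)" where
  "orbit_row q \<tau> i = (case i of
      Inl e \<Rightarrow> rigidity_row q e
    | Inr (h, v) \<Rightarrow> \<chi> c. if fst c = v then - (\<tau> h $ snd c) else 0)"

lemma finite_orbit_index: "finite (orbit_index (EH :: 'v::finite set set) \<kappa>)"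
  by (simp add: orbit_index_def)

lemma card_orbit_index:
  "card (orbit_index (EH :: 'v::finite set set) \<kappa>) =
    card EH + card {h. \<kappa> $ h = 1} * CARD('v)"
  by (simp add: orbit_index_def card_Plus card_cartesian_product)

lemma orbit_row_Inr_inner:
  "orbit_row q \<tau> (Inr (h, v)) \<bullet> w = - (\<tau> h \<bullet> velocity w v)"
proof -
  have "velocity (orbit_row q \<tau> (Inr (h, v))) x = (if x = v then - \<tau> h else 0)" for x
    by (simp add: orbit_row_def vec_eq_iff)
  then have "orbit_row q \<tau> (Inr (h, v)) \<bullet> w =
      (\<Sum>x\<in>UNIV. if x = v then - (\<tau> h \<bullet> velocity w v) else 0)"
    unfolding inner_eq_sum_velocity by (intro sum.cong) auto
  then show ?thesis
    by simp
qed

lemma sum_orbit_rows_nth: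
  fixes c :: "'v::finite set + 't::finite \<times> 'v \<Rightarrow> real"
  assumes "simple_graph EH"
  shows "(\<Sum>i\<in>orbit_index EH \<kappa>. c i *\<^sub>R orbit_row q \<tau> i) $ (v, k) =
    (\<Sum>w | {v, w} \<in> EH. c (Inl {v, w}) * (q v - q w) $ k) -
    (\<Sum>h | \<kappa> $ h = 1. c (Inr (h, v)) * \<tau> h $ k)"
proof -
  have "(\<Sum>i\<in>orbit_index EH \<kappa>. c i *\<^sub>R orbit_row q \<tau> i) $ (v, k) =
      (\<Sum>e\<in>EH. c (Inl e) *\<^sub>R rigidity_row q e) $ (v, k) +
      (\<Sum>(h, x)\<in>{h. \<kappa> $ h = 1} \<times> UNIV. c (Inr (h, x)) * (if v = x then - (\<tau> h $ k) else 0))"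
    unfolding orbit_index_def
    by (subst sum.Plus) (simp_all add: orbit_row_def split_beta cong: if_cong)
  also have "(\<Sum>(h, x)\<in>{h. \<kappa> $ h = 1} \<times> UNIV.
        c (Inr (h, x)) * (if v = x then - (\<tau> h $ k) else 0)) =
      (\<Sum>h | \<kappa> $ h = 1. \<Sum>x\<in>UNIV. if v = x then - (c (Inr (h, v)) * \<tau> h $ k) else 0)"
    unfolding sum.cartesian_product[symmetric] by (intro sum.cong) auto
  finally show ?thesis
    unfolding sum_rigidity_rows_nth[OF assms] by (simp add: sum_negf)
qed

text \<open>
  The orientation sign \<open>\<plusminus>1\<close> of an extruded edge makes the value independent of the endpoint; the
  sum over the two endpoints, divided by 2, avoids choosing one of them.
\<close>

definition stress_lift ::
    "'v::finite set set \<Rightarrow> bit ^ 't::finite \<Rightarrow> ('v set + 't \<times> 'v \<Rightarrow> real) \<Rightarrow>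
      ('v \<times> (bit ^ 't)) set \<Rightarrow> real" where
  "stress_lift EH \<kappa> c e =
    (\<Sum>(v, a)\<in>e. irrep \<kappa> a *
      (if fst ` e \<in> EH then c (Inl (fst ` e))
       else \<Sum>h | \<kappa> $ h = 1 \<and> (v, a + axis h 1) \<in> e.
         (if a $ h = 1 then - 1 else 1) * c (Inr (h, v)))) / 2"

lemma stress_lift_base:
  assumes "simple_graph EH" and "{v, w} \<in> EH"
  shows "stress_lift EH \<kappa> c {(v, a), (w, a)} = irrep \<kappa> a * c (Inl {v, w})"
  using assms(2) simple_graph_neq[OF assms] by (simp add: stress_lift_def)

text \<open>If \<open>\<kappa> $ h = 1\<close>, passing to the other end flips both
  \<open>irrep \<kappa>\<close> and the orientation sign, so both ends contribute the same term and
  halving leaves one of them.\<close>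

lemma stress_lift_extruded:
  fixes EH :: "'v::finite set set"
  assumes "simple_graph EH"
  shows "stress_lift EH \<kappa> c {(v, a), (v, a + axis h 1)} =
    (if \<kappa> $ h = 1 then irrep \<kappa> a * (if a $ h = 1 then - 1 else 1) * c (Inr (h, v)) else 0)"
proof -
  let ?e = "{(v, a), (v, a + axis h 1)}"
  \<comment> \<open>Both ends project to the same vertex of H; this is how
    \<open>stress_lift\<close> tells extruded edges from base edges.\<close>
  have "fst ` ?e \<notin> EH"
    using assms by (auto simp: simple_graph_def)
  moreover have "{h'. \<kappa> $ h' = 1 \<and> (v, a + axis h' 1) \<in> ?e} = (if \<kappa> $ h = 1 then {h} else {})"
    by (auto simp: axis_eq_axis)
  moreover have "{h'. \<kappa> $ h' = 1 \<and> (v, a + axis h 1 + axis h' 1) \<in> ?e} =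
      (if \<kappa> $ h = 1 then {h} else {})"
    by (auto simp: axis_eq_axis add.assoc bit_vec_add_eq_0_iff)
  ultimately show ?thesis
    using axis_1_neq_0[of h]
    by (cases "a $ h") (simp_all add: stress_lift_def irrep_add)
qed

lemma symmetric_stress_stress_lift:
  fixes EH :: "'v::finite set set" and \<kappa> :: "bit ^ 't::finite"
  assumes EH: "simple_graph EH"
  shows "symmetric_stress (extrusion_edges EH) \<kappa> (stress_lift EH \<kappa> c)"
  unfolding symmetric_stress_def
proof (intro allI ballI)
  fix \<gamma> :: "bit ^ 't" and e :: "('v \<times> (bit ^ 't)) set"
  assume e: "e \<in> extrusion_edges EH"
  let ?\<omega> = "stress_lift EH \<kappa> c"
  have "(\<Sum>f\<in>extrusion_edges EH. internal_rep \<gamma> e f * ?\<omega> f) =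
      (\<Sum>f\<in>extrusion_edges EH. if f = act \<gamma> ` e then edge_sign \<gamma> e * ?\<omega> (act \<gamma> ` e) else 0)"
    by (intro sum.cong) (auto simp: internal_rep_eq)
  also have "\<dots> = edge_sign \<gamma> e * ?\<omega> (act \<gamma> ` e)"
    using act_extrusion_edges[OF e] by simp
  also have "\<dots> = irrep \<kappa> \<gamma> * ?\<omega> e"
  proof -
    consider v w a where "e = {(v, a), (w, a)}" "{v, w} \<in> EH"
      | v a h where "e = {(v, a), (v, a + axis h 1)}"
      using e by (auto simp: extrusion_edges_eq base_edges_def extruded_edges_def)
    then show ?thesis
    proof cases
      case (1 v w a)
      then show ?thesis
        using EH by (simp add: stress_lift_base edge_sign_base simple_graph_neq[OF EH] irrep_add)
    next
      case (2 v a h)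
      then have "act \<gamma> ` e = {(v, a + \<gamma>), (v, (a + \<gamma>) + axis h 1)}"
        by (simp add: add_ac)
      then have "?\<omega> (act \<gamma> ` e) =
          (if \<kappa> $ h = 1
           then irrep \<kappa> (a + \<gamma>) * (if (a + \<gamma>) $ h = 1 then - 1 else 1) * c (Inr (h, v)) else 0)"
        by (simp only: stress_lift_extruded[OF EH])
      \<comment> \<open>If \<open>\<gamma> $ h = 1\<close>, then \<gamma> reverses the orientation
        sign, and \<open>edge_sign\<close> cancels this change.\<close>
      then show ?thesis
        using 2
        by (cases "a $ h"; cases "\<gamma> $ h")
          (simp_all add: stress_lift_extruded[OF EH] edge_sign_extruded irrep_add)
    qed
  qed
  finally show "(\<Sum>f\<in>extrusion_edges EH. internal_rep \<gamma> e f * ?\<omega> f) = irrep \<kappa> \<gamma> * ?\<omega> e" .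
qed

text \<open>At layer 0 the character and the orientation sign are 1, so the edges there carry the
  coefficients c unchanged.\<close>

lemma stress_lift_nonzero:
  fixes EH :: "'v::finite set set"
  assumes EH: "simple_graph EH" and "\<exists>i\<in>orbit_index EH \<kappa>. c i \<noteq> 0"
  shows "\<exists>e\<in>extrusion_edges EH. stress_lift EH \<kappa> c e \<noteq> 0"
proof -
  obtain i where i: "i \<in> orbit_index EH \<kappa>" "c i \<noteq> 0"
    using assms(2) by blast
  then consider e where "i = Inl e" "e \<in> EH" | h v where "i = Inr (h, v)" "\<kappa> $ h = 1"
    by (auto simp: orbit_index_def)
  then show ?thesis
  proof cases
    case (1 e)
    then obtain v w where vw: "e = {v, w}"
      using EH unfolding simple_graph_def card_2_iff by blast
    then have "{(v, 0), (w, 0)} \<in> extrusion_edges EH"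
      using 1 by (auto simp: extrusion_edges_eq base_edges_def)
    moreover have "stress_lift EH \<kappa> c {(v, 0), (w, 0)} \<noteq> 0"
      using 1 vw i(2) EH by (simp add: stress_lift_base)
    ultimately show ?thesis
      by blast
  next
    case (2 h v)
    have "{(v, 0), (v, 0 + axis h 1)} \<in> extrusion_edges EH"
      unfolding extrusion_edges_eq extruded_edges_def by fast
    moreover have "stress_lift EH \<kappa> c {(v, 0), (v, 0 + axis h 1)} \<noteq> 0"
      unfolding stress_lift_extruded[OF EH] using 2 i(2) by simp
    ultimately show ?thesis
      by blast
  qed
qed

section \<open>Lifting kernel and cokernel of the block for fixed extrusion vectors\<close>

locale extrusion_framework =
  fixes EH :: "'v::finite set set"
    and p :: "'v \<times> (bit ^ 't::finite) \<Rightarrow> real ^ 'd::finite"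
    and \<tau> :: "'t \<Rightarrow> real ^ 'd"
  assumes simple: "simple_graph EH"
    and direction_nonzero: "\<tau> h \<noteq> 0"
    and position_act: "p (act \<gamma> (v, a)) =
        p (v, a) + (\<Sum>i\<in>{i. a $ i = 0 \<and> \<gamma> $ i = 1}. \<tau> i)
                 - (\<Sum>i\<in>{i. a $ i = 1 \<and> \<gamma> $ i = 1}. \<tau> i)"
begin

abbreviation base_position :: "'v \<Rightarrow> real ^ 'd" where
  "base_position v \<equiv> p (v, 0)"

lemma position_axis:
  "p (v, a + axis h 1) = p (v, a) + (if a $ h = 1 then - 1 else 1) *\<^sub>R \<tau> h"
proof -
  have "{i. a $ i = x \<and> axis h (1::bit) $ i = 1} = (if a $ h = x then {h} else {})" for x
    by (auto simp: axis_def split: if_splits)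
  then show ?thesis
    using position_act[of "axis h 1" v a] by (cases "a $ h") simp_all
qed

text \<open>Layer a is the translate of layer 0 by the sum of the vectors \<open>\<tau> i\<close>
  with \<open>a $ i = 1\<close>.\<close>

lemma position_diff: "p (v, a) - p (w, a) = base_position v - base_position w"
  using position_act[of a v 0] position_act[of a w 0] by simp

lemma infinitesimal_motion_symmetric_lift:
  assumes w: "\<forall>i\<in>orbit_index EH \<kappa>. orbit_row base_position \<tau> i \<bullet> w = 0"
  shows "infinitesimal_motion (extrusion_edges EH) p (symmetric_lift \<kappa> w)"
  unfolding infinitesimal_motion_def
proof
  fix e :: "('v \<times> (bit ^ 't)) set" assume "e \<in> extrusion_edges EH"
  then consider v x a where "e = {(v, a), (x, a)}" "{v, x} \<in> EH"
    | v a h where "e = {(v, a), (v, a + axis h 1)}"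
    by (auto simp: extrusion_edges_eq base_edges_def extruded_edges_def)
  then show "rigidity_row p e \<bullet> symmetric_lift \<kappa> w = 0"
  proof cases
    case (1 v x a)
    then have vx: "v \<noteq> x"
      using simple_graph_neq[OF simple] by blast
    have "orbit_row base_position \<tau> (Inl {v, x}) \<bullet> w = 0"
      using w 1 by (auto simp: orbit_index_def)
    then have "(base_position v - base_position x) \<bullet> (velocity w v - velocity w x) = 0"
      using vx by (simp add: orbit_row_def rigidity_row_inner)
    then show ?thesis
      using vx 1
      by (simp add: rigidity_row_inner velocity_symmetric_lift position_diff[of v a x]
          flip: scaleR_diff_right)
  next
    case (2 v a h)
    have "rigidity_row p e \<bullet> symmetric_lift \<kappa> w =
        (p (v, a) - p (v, a + axis h 1)) \<bullet>
          (irrep \<kappa> a *\<^sub>R velocity w v - irrep \<kappa> (a + axis h 1) *\<^sub>R velocity w v)"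
      unfolding 2
      by (subst rigidity_row_inner) (use axis_1_neq_0[of h] in \<open>auto simp: velocity_symmetric_lift\<close>)
    also have "\<dots> = 0"
    \<comment> \<open>In the first case the ends have opposite velocities, and the orbit row makes
      these orthogonal to \<open>\<tau> h\<close>.\<close>
    proof (cases "\<kappa> $ h = 1")
      case True
      then have "orbit_row base_position \<tau> (Inr (h, v)) \<bullet> w = 0"
        using w by (auto simp: orbit_index_def)
      then have "\<tau> h \<bullet> velocity w v = 0"
        by (simp add: orbit_row_Inr_inner)
      then show ?thesis
        by (simp add: position_axis inner_diff_right)
    qed (simp add: irrep_add)
    finally show ?thesis .
  qed
qed

text \<open>The force balance at \<open>(v, a)\<close> is \<open>irrep \<kappa> a\<close> times the
  columns of v in the relation among orbit rows, so all layers impose the same equations.\<close>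

lemma self_stress_stress_lift:
  assumes c: "(\<Sum>i\<in>orbit_index EH \<kappa>. c i *\<^sub>R orbit_row base_position \<tau> i) = 0"
  shows "self_stress (extrusion_edges EH) p (stress_lift EH \<kappa> c)"
proof -
  let ?\<omega> = "stress_lift EH \<kappa> c"
  have "(\<Sum>e\<in>extrusion_edges EH. ?\<omega> e *\<^sub>R rigidity_row p e) $ ((v, a), k) = 0" for v a k
  proof -
    let ?g = "\<lambda>y. ?\<omega> {(v, a), y} * (p (v, a) - p y) $ k"
    have inj: "inj_on (\<lambda>w. (w, a)) A" "inj (\<lambda>h. (v, a + axis h (1::bit)))" for A
      by (auto simp: inj_on_def axis_eq_axis)
    have "(v, a + axis h 1) \<noteq> (w, a)" for h and w :: 'v
      using axis_1_neq_0[of h] by simp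
    then have disj: "(\<lambda>w. (w, a)) ` {w. {v, w} \<in> EH} \<inter> range (\<lambda>h. (v, a + axis h 1)) = {}"
      by fastforce
    have "(\<Sum>e\<in>extrusion_edges EH. ?\<omega> e *\<^sub>R rigidity_row p e) $ ((v, a), k) =
        (\<Sum>w | {v, w} \<in> EH. ?g (w, a)) + (\<Sum>h\<in>UNIV. ?g (v, a + axis h 1))"
      unfolding sum_rigidity_rows_nth[OF simple_graph_extrusion_edges[OF simple]]
        extrusion_edges_neighbours[OF simple]
      by (subst sum.union_disjoint[OF _ _ disj])
        (simp_all add: sum.reindex[OF inj(1)] sum.reindex[OF inj(2)])
    also have "(\<Sum>w | {v, w} \<in> EH. ?g (w, a)) =
        irrep \<kappa> a * (\<Sum>w | {v, w} \<in> EH. c (Inl {v, w}) * (base_position v - base_position w) $ k)"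
      unfolding sum_distrib_left
      by (intro sum.cong)
        (simp_all only: stress_lift_base[OF simple] position_diff[of v a] mem_Collect_eq mult.assoc)
    \<comment> \<open>The orientation sign of the stress cancels the sign in
      \<open>position_axis\<close>, leaving the minus sign of \<open>orbit_row\<close>.\<close>
    also have "(\<Sum>h\<in>UNIV. ?g (v, a + axis h 1)) =
        (\<Sum>h\<in>UNIV. if \<kappa> $ h = 1 then - (irrep \<kappa> a * (c (Inr (h, v)) * \<tau> h $ k)) else 0)"
      by (intro sum.cong) (simp_all add: stress_lift_extruded[OF simple] position_axis)
    also have "\<dots> = - (irrep \<kappa> a * (\<Sum>h | \<kappa> $ h = 1. c (Inr (h, v)) * \<tau> h $ k))"
      by (simp add: sum.If_cases sum_negf sum_distrib_left)
    also have "irrep \<kappa> a * (\<Sum>w | {v, w} \<in> EH. c (Inl {v, w}) * (base_position v - base_position w) $ k)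
        + \<dots> = irrep \<kappa> a * (\<Sum>i\<in>orbit_index EH \<kappa>. c i *\<^sub>R orbit_row base_position \<tau> i) $ (v, k)"
      unfolding sum_orbit_rows_nth[OF simple] by (simp add: right_diff_distrib)
    finally show ?thesis
      by (simp add: c)
  qed
  then show ?thesis
    by (auto simp: self_stress_def vec_eq_iff)
qed

section \<open>Trivial symmetric motions in the plane\<close>

lemma trivial_symmetric_lift_0:
  assumes "CARD('d) = 2" and "trivial_motion p (symmetric_lift 0 w)"
  shows "w \<in> infinitesimal_translations"
proof -
  obtain S b where skew: "transpose S = - S"
    and Sb: "\<And>i. velocity (symmetric_lift 0 w) i = S *v p i + b"
    using assms(2) by (auto simp: trivial_motion_def)
  have Sb: "velocity w v = S *v p (v, a) + b" for v a
    using Sb[of "(v, a)"] by (simp add: velocity_symmetric_lift)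
  \<comment> \<open>Both ends of an extruded edge have the same velocity. As there is at least one
    direction, S kills a non-zero vector.\<close>
  have "S *v \<tau> h = 0" for h
    using Sb[of _ "0 + axis h 1"] Sb[of _ 0] unfolding position_axis
    by (simp add: matrix_vector_right_distrib)
  then have "S = 0"
    using skew_symmetric_2_injective[OF assms(1) skew] direction_nonzero by blast
  then show ?thesis
    using Sb by (auto simp: infinitesimal_translations_def)
qed

text \<open>
  The only trivial motions that are symmetric with respect to a non-trivial \<open>\<rho>\<^sub>\<kappa>\<close> are rotations of a
  framework whose points take only two positions, swapped by the symmetry.
\<close>

lemma trivial_symmetric_lift_nonzero:
  assumes "CARD('d) = 2" and "\<kappa> \<noteq> 0" and "w \<noteq> 0"
    and "trivial_motion p (symmetric_lift \<kappa> w)"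
  shows "CARD('t) = 1" and "velocity w v = velocity w v'"
    and "base_position v = base_position v'"
proof -
  obtain S b where skew: "transpose S = - S"
    and Sb: "\<And>i. velocity (symmetric_lift \<kappa> w) i = S *v p i + b"
    using assms(4) by (auto simp: trivial_motion_def)
  have Sb: "irrep \<kappa> a *\<^sub>R velocity w v = S *v p (v, a) + b" for v a
    using Sb[of "(v, a)"] by (simp add: velocity_symmetric_lift)
  \<comment> \<open>Subtract the formula \<open>Sb\<close> at the two ends of an edge in direction
    h.\<close>
  have step: "(if a $ h = 1 then - 1 else 1) *\<^sub>R (S *v \<tau> h) =
      (irrep \<kappa> (axis h 1) - 1) *\<^sub>R irrep \<kappa> a *\<^sub>R velocity w v" for a h v
  proof -
    have "(if a $ h = 1 then - 1 else 1) *\<^sub>R (S *v \<tau> h) =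
        irrep \<kappa> (a + axis h 1) *\<^sub>R velocity w v - irrep \<kappa> a *\<^sub>R velocity w v"
      unfolding Sb position_axis
      by (simp add: matrix_vector_right_distrib matrix_vector_mult_scaleR)
    then show ?thesis
      by (simp add: irrep_add scaleR_diff_left left_diff_distrib)
  qed
  \<comment> \<open>If S were 0, all velocities would be b, whereas a direction with
    \<open>\<kappa> $ h = 1\<close> reverses them.\<close>
  have "S \<noteq> 0"
  proof
    assume "S = 0"
    then have b: "irrep \<kappa> a *\<^sub>R velocity w v = b" for a v
      using Sb by simp
    obtain h where "\<kappa> $ h = 1"
      using assms(2) by (auto simp: vec_eq_iff)
    then have "velocity w v = 0" for v
      using b[of 0 v] b[of "axis h 1" v] by (intro eq_uminus_self_imp_0) simp
    then have "w = 0"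
      by (auto simp: vec_eq_iff)
    with assms(3) show False ..
  qed
  then have inj: "S *v x = 0 \<Longrightarrow> x = 0" for x
    using skew_symmetric_2_injective[OF assms(1) skew] by blast
  have \<kappa>: "\<kappa> $ h = 1" for h
  proof (rule ccontr)
    assume "\<kappa> $ h \<noteq> 1"
    then have "S *v \<tau> h = 0"
      using step[of 0 h] by simp
    then show False
      using inj direction_nonzero by blast
  qed
  have w: "S *v \<tau> h = - 2 *\<^sub>R velocity w v" for h v
    using step[of 0 h v] \<kappa>[of h] by simp
  \<comment> \<open>Here \<open>undefined\<close> is just some direction; index types are
    non-empty.\<close>
  show same: "velocity w v = velocity w v'" for v v'
    using w[of undefined v] w[of undefined v'] by simp
  have "S *v (base_position v - base_position v') = 0"
    using Sb[of 0 v] Sb[of 0 v'] same[of v v'] by (simp add: matrix_vector_mult_diff_distrib)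
  then show "base_position v = base_position v'"
    using inj by fastforce
  \<comment> \<open>With a second direction, an edge in direction h can also be read from layer
    \<open>axis h' 1\<close>. There the velocity is reversed but the orientation is not, so
    \<open>S *v \<tau> h\<close> equals both 2 and -2 times the velocity.\<close>
  have "h = h'" for h h' :: 't
  proof (rule ccontr)
    assume "h \<noteq> h'"
    then have "axis h' (1::bit) $ h = 0"
      by (simp add: axis_def)
    then have "S *v \<tau> h = 2 *\<^sub>R velocity w v"
      using step[of "axis h' 1" h v] \<kappa>[of h] \<kappa>[of h'] by simp
    then have "velocity w v = 0"
      using w[of h v] eq_uminus_self_imp_0[of "2 *\<^sub>R velocity w v"] by simp
    then show False
      using w[of h v] inj direction_nonzero by fastforce
  qed
  then show "CARD('t) = 1"
    by (metis (full_types) UNIV_eq_I card_1_singleton_iff One_nat_def singleton_iff)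
qed

text \<open>The kernel \<open>K\<close> of the block is larger than the multiplicity of the
  translations. In the plane, if \<kappa> = 0 then \<open>K\<close> cannot consist of translations
  only; if \<kappa> is non-zero, the assumption that every lift is trivial is refuted as soon as H
  has two vertices.\<close>

lemma symmetric_motion_exists:
  assumes "CARD('v) * CARD('d) > (if \<kappa> = 0 then CARD('d) else 0) + card (orbit_index EH \<kappa>)"
  shows "\<exists>u. infinitesimal_motion (extrusion_edges EH) p u \<and> u \<noteq> 0 \<and> symmetric_motion \<kappa> u"
    and "CARD('d) = 2 \<Longrightarrow> CARD('v \<times> (bit ^ 't)) \<noteq> 2 \<Longrightarrow>
      \<exists>u. infinitesimal_motion (extrusion_edges EH) p u \<and> \<not> trivial_motion p u \<and> symmetric_motion \<kappa> u"
proof -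
  define K where "K = {w. \<forall>i\<in>orbit_index EH \<kappa>. orbit_row base_position \<tau> i \<bullet> w = 0}"
  have motion: "infinitesimal_motion (extrusion_edges EH) p (symmetric_lift \<kappa> w)" if "w \<in> K" for w
    using that infinitesimal_motion_symmetric_lift by (simp add: K_def)
  have dim: "dim K > (if \<kappa> = 0 then CARD('d) else 0)"
    using assms
      DIM_le_dim_orthogonal_plus_card[OF finite_orbit_index, of EH \<kappa> "orbit_row base_position \<tau>"]
    by (simp add: K_def card_cartesian_product)
  have "\<not> K \<subseteq> {0}"
    using dim dim_eq_0[of K] by linarith
  then obtain w where w: "w \<in> K" "w \<noteq> 0"
    by blast
  show "\<exists>u. infinitesimal_motion (extrusion_edges EH) p u \<and> u \<noteq> 0 \<and> symmetric_motion \<kappa> u"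
    using motion[OF w(1)] w(2) symmetric_motion_symmetric_lift symmetric_lift_eq_0_iff by blast
  assume d: "CARD('d) = 2" and card: "CARD('v \<times> (bit ^ 't)) \<noteq> 2"
  have "\<exists>w'\<in>K. \<not> trivial_motion p (symmetric_lift \<kappa> w')"
  proof (cases "\<kappa> = 0")
    case True
    have "\<not> K \<subseteq> infinitesimal_translations"
      using dim dim_subset[of K infinitesimal_translations] True
      by (auto simp: dim_infinitesimal_translations)
    then show ?thesis
      using trivial_symmetric_lift_0[OF d] True by blast
  next
    case False
    show ?thesis
    proof (rule ccontr)
      assume "\<not> ?thesis"
      then have triv: "trivial_motion p (symmetric_lift \<kappa> w)" if "w \<in> K" for w
        using that by blast
      note w_triv = trivial_symmetric_lift_nonzero[OF d False w(2) triv[OF w(1)]]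
      have "CARD(bit) = 2"
      proof -
        have "(UNIV :: bit set) = {0, 1}"
          by (auto intro: bit.exhaust)
        then show ?thesis
          by (metis card_2_iff zero_neq_one)
      qed
      with card w_triv(1) have "CARD('v) \<noteq> 1"
        by (auto simp: card_cartesian_product)
      obtain v k where v: "w $ (v, k) \<noteq> 0"
        using w(2) by (auto simp: vec_eq_iff)
      obtain v' where v': "v' \<noteq> v"
        using \<open>CARD('v) \<noteq> 1\<close>
        by (metis (full_types) UNIV_eq_I card_1_singleton_iff One_nat_def singleton_iff)
      \<comment> \<open>All points of H coincide, so the edge rows of H vanish and the velocities of
        its vertices may be altered independently. Keeping only that of v stays in \<open>K\<close>
        but makes the velocities at v and v' differ.\<close>
      define w' where "w' = (\<chi> c. if fst c = v then w $ c else 0)"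
      have vel: "velocity w' x = (if x = v then velocity w v else 0)" for x
        by (auto simp: w'_def vec_eq_iff)
      have "w' \<in> K"
        unfolding K_def
      proof safe
        fix i assume i: "i \<in> orbit_index EH \<kappa>"
        then consider e where "i = Inl e" "e \<in> EH" | h x where "i = Inr (h, x)"
          by (auto simp: orbit_index_def)
        then show "orbit_row base_position \<tau> i \<bullet> w' = 0"
        proof cases
          case (1 e)
          then obtain x y where "e = {x, y}" "x \<noteq> y"
            using simple unfolding simple_graph_def card_2_iff by blast
          then show ?thesis
            using 1 w_triv(3)[of x y] by (simp add: orbit_row_def rigidity_row_inner)
        next
          case (2 h x)
          then have "(Inr (h, v) :: 'v set + 't \<times> 'v) \<in> orbit_index EH \<kappa>"
            using i by (auto simp: orbit_index_def)
          then have "orbit_row base_position \<tau> (Inr (h, v)) \<bullet> w = 0"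
            using w(1) by (auto simp: K_def)
          then show ?thesis
            using 2 by (simp add: orbit_row_Inr_inner vel)
        qed
      qed
      moreover have "w' \<noteq> 0"
        using v by (auto simp: w'_def vec_eq_iff)
      ultimately have "velocity w' v = velocity w' v'"
        using trivial_symmetric_lift_nonzero(2)[OF d False _ triv] by blast
      then show False
        using v v' by (auto simp: vel vec_eq_iff)
    qed
  qed
  then show "\<exists>u. infinitesimal_motion (extrusion_edges EH) p u \<and> \<not> trivial_motion p u \<and>
      symmetric_motion \<kappa> u"
    using motion symmetric_motion_symmetric_lift by blast
qed

text \<open>For \<kappa> = 0 the block consists of edge rows of H, all orthogonal to the
  translations, which lowers the bound on its rank by \<open>CARD('d)\<close>. In either case there
  are more rows than the rank.\<close>

lemma symmetric_stress_exists:
  assumes "CARD('v) * CARD('d) < (if \<kappa> = 0 then CARD('d) else 0) + card (orbit_index EH \<kappa>)"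
  shows "\<exists>\<omega>. self_stress (extrusion_edges EH) p \<omega> \<and> (\<exists>e\<in>extrusion_edges EH. \<omega> e \<noteq> 0) \<and>
    symmetric_stress (extrusion_edges EH) \<kappa> \<omega>"
proof -
  let ?R = "orbit_row base_position \<tau> ` orbit_index EH \<kappa>"
  have "dim ?R + (if \<kappa> = 0 then CARD('d) else 0) \<le> CARD('v) * CARD('d)"
  proof (cases "\<kappa> = 0")
    case True
    let ?T = "infinitesimal_translations :: (real ^ ('v \<times> 'd)) set"
    have "x \<bullet> rigidity_row base_position e = 0" if "e \<in> EH" "x \<in> ?T" for e x
      using that simple rigidity_row_orthogonal_translation[of e x base_position]
      by (simp add: simple_graph_def inner_commute)
    then have "?R \<subseteq> {y \<in> UNIV. \<forall>x\<in>?T. orthogonal x y}"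
      using True by (auto simp: orbit_index_def orbit_row_def orthogonal_def)
    then have "dim ?R \<le> dim {y \<in> UNIV. \<forall>x\<in>?T. orthogonal x y}"
      by (rule dim_subset)
    then show ?thesis
      using dim_subspace_orthogonal_to_vectors[of ?T UNIV] True
      by (simp add: subspace_infinitesimal_translations dim_infinitesimal_translations
          card_cartesian_product)
  next
    case False
    then show ?thesis
      using dim_subset_UNIV[of ?R] by (simp add: card_cartesian_product)
  qed
  then have "dim ?R < card (orbit_index EH \<kappa>)"
    using assms by linarith
  then obtain c where "(\<Sum>i\<in>orbit_index EH \<kappa>. c i *\<^sub>R orbit_row base_position \<tau> i) = 0"
    and "\<exists>i\<in>orbit_index EH \<kappa>. c i \<noteq> 0"
    using nontrivial_relation_of_dim_less_card[OF finite_orbit_index] by blast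
  then show ?thesis
    using self_stress_stress_lift stress_lift_nonzero[OF simple]
      symmetric_stress_stress_lift[OF simple] by blast
qed

end

text \<open>Two vertices are excepted in the planar claim because it fails for a single bar: for the
  non-trivial character, \<lambda> - \<nu> = 2 exceeds \<mu> = 1, but the symmetric motions are
  rotations about the midpoint and hence trivial.\<close>

theorem theorem4p2:
  fixes EH :: "'v::finite set set"
    and E :: "('v \<times> (bit ^ 't::finite)) set set"
    and p :: "'v \<times> (bit ^ 't) \<Rightarrow> real ^ 'd::finite"
    and lam mu nu :: "bit ^ 't \<Rightarrow> nat"
  assumes "simple_graph EH"
    and "E = extrusion_edges EH"
    and "extrusion_symmetry p"
    and "aff_dim (range p) \<ge> int CARD('d) - 1"
    and "\<And>\<gamma>. trace (external_rep \<gamma> :: real ^ (('v \<times> (bit ^ 't)) \<times> 'd) ^ (('v \<times> (bit ^ 't)) \<times> 'd))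
          = (\<Sum>\<kappa>\<in>UNIV. real (lam \<kappa>) * irrep \<kappa> \<gamma>)"
    and "\<And>\<gamma>. edge_trace E (internal_rep \<gamma>) = (\<Sum>\<kappa>\<in>UNIV. real (mu \<kappa>) * irrep \<kappa> \<gamma>)"
    and "\<And>\<gamma>. trace_on (infinitesimal_translations :: (real ^ (('v \<times> (bit ^ 't)) \<times> 'd)) set)
            (\<lambda>u. external_rep \<gamma> *v u)
          = (\<Sum>\<kappa>\<in>UNIV. real (nu \<kappa>) * irrep \<kappa> \<gamma>)"
  shows "\<forall>\<kappa>.
    (int (lam \<kappa>) - int (nu \<kappa>) > int (mu \<kappa>) \<longrightarrow>
      (\<exists>u. infinitesimal_motion E p u \<and> u \<noteq> 0 \<and> symmetric_motion \<kappa> u) \<and>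
      (CARD('d) = 2 \<and> CARD('v \<times> (bit ^ 't)) \<noteq> 2 \<longrightarrow>
        (\<exists>u. infinitesimal_motion E p u \<and> \<not> trivial_motion p u \<and> symmetric_motion \<kappa> u))) \<and>
    (int (lam \<kappa>) - int (nu \<kappa>) < int (mu \<kappa>) \<longrightarrow>
      (\<exists>\<omega>. self_stress E p \<omega> \<and> (\<exists>e\<in>E. \<omega> e \<noteq> 0) \<and> symmetric_stress E \<kappa> \<omega>))"
proof
  fix \<kappa> :: "bit ^ 't"
  obtain \<tau> :: "'t \<Rightarrow> real ^ 'd" where "extrusion_framework EH p \<tau>"
    using assms(1,3) unfolding extrusion_symmetry_def extrusion_framework_def by blast
  then interpret extrusion_framework EH p \<tau> .
  have lam: "lam \<kappa> = CARD('v) * CARD('d)"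
    by (rule external_multiplicity[OF assms(5)])
  have mu: "mu \<kappa> = card (orbit_index EH \<kappa>)"
    unfolding card_orbit_index
    by (rule internal_multiplicity[OF assms(1) assms(6)[unfolded assms(2)]])
  have nu: "nu \<kappa> = (if \<kappa> = 0 then CARD('d) else 0)"
    by (rule translation_multiplicity[OF assms(7)])
  have "int (lam \<kappa>) - int (nu \<kappa>) > int (mu \<kappa>) \<longleftrightarrow> nu \<kappa> + mu \<kappa> < lam \<kappa>"
    "int (lam \<kappa>) - int (nu \<kappa>) < int (mu \<kappa>) \<longleftrightarrow> lam \<kappa> < nu \<kappa> + mu \<kappa>"
    by linarith+
  then show "(int (lam \<kappa>) - int (nu \<kappa>) > int (mu \<kappa>) \<longrightarrow>
      (\<exists>u. infinitesimal_motion E p u \<and> u \<noteq> 0 \<and> symmetric_motion \<kappa> u) \<and>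
      (CARD('d) = 2 \<and> CARD('v \<times> (bit ^ 't)) \<noteq> 2 \<longrightarrow>
        (\<exists>u. infinitesimal_motion E p u \<and> \<not> trivial_motion p u \<and> symmetric_motion \<kappa> u))) \<and>
    (int (lam \<kappa>) - int (nu \<kappa>) < int (mu \<kappa>) \<longrightarrow>
      (\<exists>\<omega>. self_stress E p \<omega> \<and> (\<exists>e\<in>E. \<omega> e \<noteq> 0) \<and> symmetric_stress E \<kappa> \<omega>))"
    unfolding assms(2)
    using symmetric_motion_exists[of \<kappa>, folded lam mu nu]
      symmetric_stress_exists[of \<kappa>, folded lam mu nu]
    by simp
qed

end
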